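(* The sets of patterns $\{112,2212\}$ and $\{121,2122\}$ are $m$-equivalent, that is, $\{112,2212\}\sim\{121,2122\}$.
   Context: A (finite, reduced) multiset is $S=1^{a_1}2^{a_2}\cdots k^{a_k}$ with $k\ge 1$ and all $a_i\ge 1$, meaning that $i$ occurs with multiplicity $a_i$. A multipermutation of $S$ is a word having exactly $a_i$ occurrences of each letter $i\in[k]=\{1,\dots,k\}$ and no other letters. A word $\pi=\pi_1\cdots\pi_n$ contains a pattern (word) $\rho=\rho_1\cdots\rho_\ell$ if there are indices $i(1)<\cdots<i(\ell)$ such that for all $a,b\in[\ell]$: $\pi_{i(a)}<\pi_{i(b)}$ iff $\rho_a<\rho_b$, and $\pi_{i(a)}>\pi_{i(b)}$ iff $\rho_a>\rho_b$; otherwise $\pi$ avoids $\rho$. For a set $P$ of patterns, $\mathrm{av}(S;P)$ is the number of multipermutations of $S$ that avoid every pattern in $P$. Two sets of patterns $P,Q$ are $m$-equivalent, written here $P\sim Q$, if $\mathrm{av}(S;P)=\mathrm{av}(S;Q)$ for every multiset $S$. *)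

theory Defs
  imports "HOL-Combinatorics.Multiset_Permutations"
begin

definition reduced_multiset :: "nat multiset \<Rightarrow> bool" where
  "reduced_multiset S \<longleftrightarrow> (\<exists>k\<ge>1. set_mset S = {1..k})"

text \<open>Positions in words are counted from 0, following the list library; the map \<open>i\<close> is only
  relevant on the positions of \<open>\<rho>\<close>.\<close>
definition contains_pattern :: "nat list \<Rightarrow> nat list \<Rightarrow> bool" where
  "contains_pattern \<pi> \<rho> \<longleftrightarrow>
    (\<exists>i :: nat \<Rightarrow> nat.
      strict_mono_on {..<length \<rho>} i \<and>
      (\<forall>a<length \<rho>. i a < length \<pi>) \<and>
      (\<forall>a<length \<rho>. \<forall>b<length \<rho>.
        (\<pi> ! i a < \<pi> ! i b \<longleftrightarrow> \<rho> ! a < \<rho> ! b) \<and>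
        (\<pi> ! i a > \<pi> ! i b \<longleftrightarrow> \<rho> ! a > \<rho> ! b)))"

definition avoids :: "nat list \<Rightarrow> nat list \<Rightarrow> bool" where
  "avoids \<pi> \<rho> \<longleftrightarrow> \<not> contains_pattern \<pi> \<rho>"

definition av :: "nat multiset \<Rightarrow> nat list set \<Rightarrow> nat" where
  "av S P = card {\<pi> \<in> permutations_of_multiset S. \<forall>\<rho>\<in>P. avoids \<pi> \<rho>}"

definition m_equivalent :: "nat list set \<Rightarrow> nat list set \<Rightarrow> bool" where
  "m_equivalent P Q \<longleftrightarrow> (\<forall>S. reduced_multiset S \<longrightarrow> av S P = av S Q)"

end

theory Submission
  imports Defs "HOL-Library.Sublist"
begin

text \<open>Reversing words turns \<open>{121, 2122}\<close> into \<open>{121, 2212}\<close>. In a word avoiding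
  \<open>2212\<close> and \<open>112\<close> (or \<open>121\<close>), the second to last copies of each letter are contiguous.
  Remove the smallest letter \<open>x\<close>: avoiding \<open>112\<close> forces all its copies but the first to the end
  of the word, while avoiding \<open>121\<close> forces its copies to form one block. In both cases the first
  copy may go into any gap of the remaining word that has no second copy of a letter before it
  together with a further copy after it. By contiguity the bad gaps are those directly before a
  third or later copy of a letter, so there are \<open>1 + (\<Sum>b. min 2 (mult b))\<close> good gaps, a number
  depending only on the multiset. Hence both counts satisfy the same product recursion.\<close>

section \<open>Pattern containment in terms of subsequences\<close>

text \<open>Links the positional form of pattern containment with the inductive
  \<open>subseq\<close>. From an index map, induct on \<open>ys\<close>: the head of
  \<open>ys\<close> is used exactly if \<open>i 0 = 0\<close>, and the remaining indices shift down
  by one.\<close>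

lemma subseq_iff_index_map:
  "subseq xs ys \<longleftrightarrow>
    (\<exists>i. strict_mono_on {..<length xs} i \<and> (\<forall>a<length xs. i a < length ys \<and> xs ! a = ys ! i a))"
proof
  assume "subseq xs ys"
  then show "\<exists>i. strict_mono_on {..<length xs} i \<and> (\<forall>a<length xs. i a < length ys \<and> xs ! a = ys ! i a)"
  proof (induction rule: list_emb.induct)
    case (list_emb_Nil ys)
    then show ?case by (auto simp: strict_mono_on_def)
  next
    case (list_emb_Cons xs ys y)
    then obtain i where "strict_mono_on {..<length xs} i"
      "\<forall>a<length xs. i a < length ys \<and> xs ! a = ys ! i a" by blast
    then show ?case
      by (intro exI[of _ "Suc \<circ> i"]) (auto simp: strict_mono_on_def)
  next
    case (list_emb_Cons2 x y xs ys)
    then obtain i where "strict_mono_on {..<length xs} i"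
      "\<forall>a<length xs. i a < length ys \<and> xs ! a = ys ! i a" by blast
    with \<open>x = y\<close> show ?case
      \<comment> \<open>The matched heads sit at position 0 on both sides; all other positions move
        up by one.\<close>
      by (intro exI[of _ "case_nat 0 (Suc \<circ> i)"])
        (auto simp: strict_mono_on_def nth_Cons split: nat.splits)
  qed
next
  assume "\<exists>i. strict_mono_on {..<length xs} i \<and> (\<forall>a<length xs. i a < length ys \<and> xs ! a = ys ! i a)"
  then show "subseq xs ys"
  proof (induction ys arbitrary: xs)
    case Nil
    then show ?case by (cases xs) auto
  next
    case (Cons y ys)
    then obtain i where mono: "strict_mono_on {..<length xs} i"
      and i: "\<forall>a<length xs. i a < length (y # ys) \<and> xs ! a = (y # ys) ! i a" by blast
    show ?case
    proof (cases xs)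
      case Nil
      then show ?thesis by simp
    next
      case (Cons x xs')
      \<comment> \<open>Strict monotonicity puts \<open>i (Suc a)\<close> above \<open>i 0\<close>,
        so the truncated subtraction of 1 below loses nothing.\<close>
      have pos: "0 < i (Suc a)" if "a < length xs'" for a
        using mono that Cons unfolding strict_mono_on_def
        by (metis gr_zeroI length_Cons lessThan_iff not_less_zero Suc_less_eq zero_less_Suc)
      have mono': "strict_mono_on {..<length xs'} (\<lambda>a. i (Suc a) - 1)"
        using mono pos Cons unfolding strict_mono_on_def
        by (auto intro!: diff_less_mono simp: Suc_le_eq)
      have i': "i (Suc a) - 1 < length ys \<and> xs' ! a = ys ! (i (Suc a) - 1)" if "a < length xs'" for a
        using pos[OF that] i[rule_format, of "Suc a"] that Cons
        by (auto simp: nth_Cons split: nat.splits)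
      have sub': "subseq xs' ys"
        by (rule Cons.IH) (use mono' i' in \<open>auto intro!: exI[of _ "\<lambda>a. i (Suc a) - 1"]\<close>)
      show ?thesis
      proof (cases "i 0")
        case 0
        with i Cons have "x = y" by force
        with sub' Cons show ?thesis by simp
      next
        case (Suc n)
        have pos': "0 < i a" if "a < length xs" for a
          using mono that Suc Cons unfolding strict_mono_on_def
          by (cases a) (use pos Cons in auto)
        have "subseq xs ys"
        proof (rule Cons.IH, intro exI conjI allI impI)
          show "strict_mono_on {..<length xs} (\<lambda>a. i a - 1)"
            using mono pos' unfolding strict_mono_on_def
            by (auto intro!: diff_less_mono simp: Suc_le_eq)
          fix a assume a: "a < length xs"
          show "i a - 1 < length ys" "xs ! a = ys ! (i a - 1)"
            using pos'[OF a] i[rule_format, OF a] by (auto simp: nth_Cons split: nat.splits)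
        qed
        then show ?thesis by (rule list_emb_Cons)
      qed
    qed
  qed
qed

text \<open>Meant for words of equal length, since only positions of \<open>\<rho>\<close> are
  compared.\<close>

definition same_relative_order :: "nat list \<Rightarrow> nat list \<Rightarrow> bool" where
  "same_relative_order \<sigma> \<rho> \<longleftrightarrow>
    (\<forall>a<length \<rho>. \<forall>b<length \<rho>. (\<sigma> ! a < \<sigma> ! b \<longleftrightarrow> \<rho> ! a < \<rho> ! b) \<and> (\<sigma> ! a > \<sigma> ! b \<longleftrightarrow> \<rho> ! a > \<rho> ! b))"

lemma contains_pattern_iff_subseq:
  "contains_pattern \<pi> \<rho> \<longleftrightarrow>
    (\<exists>\<sigma>. subseq \<sigma> \<pi> \<and> length \<sigma> = length \<rho> \<and> same_relative_order \<sigma> \<rho>)"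
  (is "_ \<longleftrightarrow> ?R")
proof
  assume "contains_pattern \<pi> \<rho>"
  then obtain i where "strict_mono_on {..<length \<rho>} i" "\<forall>a<length \<rho>. i a < length \<pi>"
    "\<forall>a<length \<rho>. \<forall>b<length \<rho>. (\<pi> ! i a < \<pi> ! i b \<longleftrightarrow> \<rho> ! a < \<rho> ! b) \<and> (\<pi> ! i a > \<pi> ! i b \<longleftrightarrow> \<rho> ! a > \<rho> ! b)"
    unfolding contains_pattern_def by blast
  then show ?R
    by (intro exI[of _ "map (\<lambda>a. \<pi> ! i a) [0..<length \<rho>]"])
      (auto simp: subseq_iff_index_map same_relative_order_def)
next
  assume ?R
  then show "contains_pattern \<pi> \<rho>"
    unfolding subseq_iff_index_map contains_pattern_def same_relative_order_def
    by (metis (no_types, lifting))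
qed

lemma contains_pattern_length3:
  "contains_pattern \<pi> [p, q, r] \<longleftrightarrow>
    (\<exists>x y z. subseq [x, y, z] \<pi> \<and> same_relative_order [x, y, z] [p, q, r])"
  unfolding contains_pattern_iff_subseq
  by (auto simp: length_Suc_conv simp del: list_emb_Cons_iff1 list_emb_Cons_iff2)

lemma contains_pattern_length4:
  "contains_pattern \<pi> [p, q, r, s] \<longleftrightarrow>
    (\<exists>x y z t. subseq [x, y, z, t] \<pi> \<and> same_relative_order [x, y, z, t] [p, q, r, s])"
  unfolding contains_pattern_iff_subseq
  by (auto simp: length_Suc_conv simp del: list_emb_Cons_iff1 list_emb_Cons_iff2)

text \<open>In a linear order, agreement of both strict comparisons forces agreement of equalities,
  so order isomorphism with 112 means two equal letters and then a larger one. The next three lemmas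
  treat the other patterns in the same way.\<close>

lemma contains_112_iff: "contains_pattern \<pi> [1, 1, 2] \<longleftrightarrow> (\<exists>a b. a < b \<and> subseq [a, a, b] \<pi>)"
proof -
  have order: "same_relative_order [x, y, z] [1, 1, 2] \<longleftrightarrow> x = y \<and> x < z" for x y z
    by (auto simp: same_relative_order_def All_less_Suc)
  show ?thesis unfolding contains_pattern_length3 order by blast
qed

lemma contains_121_iff: "contains_pattern \<pi> [1, 2, 1] \<longleftrightarrow> (\<exists>a b. a < b \<and> subseq [a, b, a] \<pi>)"
proof -
  have order: "same_relative_order [x, y, z] [1, 2, 1] \<longleftrightarrow> x = z \<and> x < y" for x y z
    by (auto simp: same_relative_order_def All_less_Suc)
  show ?thesis unfolding contains_pattern_length3 order by blast
qed

lemma contains_2212_iff: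
  "contains_pattern \<pi> [2, 2, 1, 2] \<longleftrightarrow> (\<exists>a b. a < b \<and> subseq [b, b, a, b] \<pi>)"
proof -
  have order: "same_relative_order [x, y, z, t] [2, 2, 1, 2] \<longleftrightarrow> x = y \<and> x = t \<and> z < x" for x y z t
    by (auto simp: same_relative_order_def All_less_Suc)
  show ?thesis unfolding contains_pattern_length4 order by blast
qed

lemma contains_2122_iff:
  "contains_pattern \<pi> [2, 1, 2, 2] \<longleftrightarrow> (\<exists>a b. a < b \<and> subseq [b, a, b, b] \<pi>)"
proof -
  have order: "same_relative_order [x, y, z, t] [2, 1, 2, 2] \<longleftrightarrow> x = z \<and> x = t \<and> y < x" for x y z t
    by (auto simp: same_relative_order_def All_less_Suc)
  show ?thesis unfolding contains_pattern_length4 order by blast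
qed

section \<open>The two classes of words and the admissible gaps\<close>

definition class_112 :: "'a::linorder list \<Rightarrow> bool" where
  "class_112 w \<longleftrightarrow> (\<forall>a b. a < b \<longrightarrow> \<not> subseq [a, a, b] w \<and> \<not> subseq [b, b, a, b] w)"

text \<open>Here 2122 appears reversed, as \<open>[b, b, a, b]\<close>, while 121 is a palindrome.
  The long pattern is then common to both classes.\<close>

definition class_121 :: "'a::linorder list \<Rightarrow> bool" where
  "class_121 w \<longleftrightarrow> (\<forall>a b. a < b \<longrightarrow> \<not> subseq [a, b, a] w \<and> \<not> subseq [b, b, a, b] w)"

text \<open>Inserting a new smallest letter between \<open>u\<close> and \<open>v\<close> creates no \<open>2212\<close>.\<close>
definition no_2212_across :: "'a list \<Rightarrow> 'a list \<Rightarrow> bool" where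
  "no_2212_across u v \<longleftrightarrow> (\<forall>b. \<not> (2 \<le> count_list u b \<and> b \<in> set v))"

text \<open>The number \<open>p\<close> stands for the gap directly before position
  \<open>p\<close>; \<open>p = length w\<close> is the gap at the end, which always
  qualifies.\<close>

definition gaps :: "'a list \<Rightarrow> nat set" where
  "gaps w = {p. p \<le> length w \<and> no_2212_across (take p w) (drop p w)}"

section \<open>Counting the admissible gaps\<close>

lemma subseq_replicate_iff: "subseq (replicate n b) u \<longleftrightarrow> n \<le> count_list u b"
proof (induction u arbitrary: n)
  case Nil
  then show ?case by (cases n) auto
next
  case (Cons c u)
  show ?case
  proof (cases n)
    case (Suc m)
    then show ?thesis
      using Cons.IH[of m] Cons.IH[of "Suc m"] by (cases "c = b") (auto dest: subseq_Cons2_neq)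
  qed simp
qed

lemma subseq_two_iff: "subseq [b, b] u \<longleftrightarrow> 2 \<le> count_list u b"
  using subseq_replicate_iff[of 2 b u] by (simp add: numeral_2_eq_2)

lemma subseq_Cons_append_notin:
  "x \<notin> set u \<Longrightarrow> subseq (x # xs) (u @ ys) \<longleftrightarrow> subseq (x # xs) ys"
  by (induction u) auto

text \<open>Only the summand of \<open>c\<close> changes: it grows by one unless it has already
  reached the cap \<open>k\<close>.\<close>

lemma sum_min_count_add:
  "(\<Sum>b\<in>set_mset (add_mset c M). min k (count (add_mset c M) b)) =
    (\<Sum>b\<in>set_mset M. min k (count M b)) + (if count M c < k then 1 else 0)"
proof -
  let ?f = "\<lambda>N b. min k (count N b)"
  have "(\<Sum>b\<in>set_mset (add_mset c M). ?f (add_mset c M) b) =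
      ?f (add_mset c M) c + (\<Sum>b\<in>set_mset M - {c}. ?f M b)"
    by (simp add: sum.insert_remove) (auto intro!: sum.cong split: if_splits)
  also have "?f (add_mset c M) c = ?f M c + (if count M c < k then 1 else 0)"
    by auto
  finally show ?thesis
    by (cases "c \<in># M") (auto simp: sum.remove[of "set_mset M" c] not_in_iff)
qed

text \<open>Each letter \<open>b\<close> contributes its first \<open>k\<close> occurrences, or all
  of them if there are fewer. Appending a letter leaves the prefixes before earlier positions
  unchanged, so only the new position has to be examined.\<close>

lemma card_early_occurrences:
  "card {p. p < length w \<and> count_list (take p w) (w ! p) < k} = (\<Sum>b\<in>set w. min k (count (mset w) b))"
proof (induction w rule: rev_induct)
  case Nil
  then show ?case by simp
next
  case (snoc c w)
  let ?P = "\<lambda>w. {p. p < length w \<and> count_list (take p w) (w ! p) < k}"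
  have "?P (w @ [c]) = ?P w \<union> (if count (mset w) c < k then {length w} else {})"
    by (auto simp: nth_append less_Suc_eq count_mset)
  then have "card (?P (w @ [c])) = card (?P w) + (if count (mset w) c < k then 1 else 0)"
    by auto
  with snoc sum_min_count_add[of k c "mset w"] show ?case by simp
qed

text \<open>A gap before position \<open>p\<close> fails exactly if \<open>w ! p\<close> is a third
  or later copy of its letter, so the good ones are counted by \<open>card_early_occurrences\<close>
  with cap 2. The \<open>Suc\<close> accounts for the gap at the end.\<close>

lemma card_gaps:
  assumes "\<And>a b. a \<noteq> b \<Longrightarrow> \<not> subseq [b, b, a, b] w"
  shows "card (gaps w) = Suc (\<Sum>b\<in>set w. min 2 (count (mset w) b))"
proof -
  have "p \<in> gaps w \<longleftrightarrow> count_list (take p w) (w ! p) < 2" if p: "p < length w" for p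
  proof -
    have d: "drop p w = w ! p # drop (Suc p) w" using p by (simp add: Cons_nth_drop_Suc)
    have "b = w ! p" if "2 \<le> count_list (take p w) b" "b \<in> set (drop p w)" for b
    proof (rule ccontr)
      assume ne: "b \<noteq> w ! p"
      \<comment> \<open>A copy of \<open>b\<close> from \<open>p\<close> on that is not at
        \<open>p\<close> itself comes after \<open>w ! p\<close>, which then separates it from the
        two earlier copies.\<close>
      then have "subseq [w ! p, b] (drop p w)"
        using that d by (auto simp: subseq_singleton_left)
      with that have "subseq ([b, b] @ [w ! p, b]) (take p w @ drop p w)"
        by (intro list_emb_append_mono) (auto simp: subseq_two_iff)
      with assms ne show False by auto
    qed
    then show ?thesis
      using p d unfolding gaps_def no_2212_across_def by (fastforce simp: not_le)
  qed
  then have "gaps w = insert (length w) {p. p < length w \<and> count_list (take p w) (w ! p) < 2}"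
    by (auto simp: gaps_def no_2212_across_def le_less)
  then show ?thesis by (simp add: card_early_occurrences)
qed


section \<open>Subsequences under reversal and around a block of one letter\<close>

lemma subseq_set_subset: "subseq xs ys \<Longrightarrow> set xs \<subseteq> set ys"
  by (auto elim: list_emb_set)

lemma subseq_rev: "subseq xs ys \<Longrightarrow> subseq (rev xs) (rev ys)"
  by (induction rule: list_emb.induct) (auto intro: list_emb_append_mono subseq_rev_drop_many)

lemma subseq_rev_iff: "subseq xs (rev ys) \<longleftrightarrow> subseq (rev xs) ys"
  using subseq_rev[of xs "rev ys"] subseq_rev[of "rev xs" ys] by auto

text \<open>The part of the subsequence that falls into \<open>zs\<close>, if nonempty, would end in
  \<open>y\<close>. This is the mirror image of \<open>subseq_Cons_append_notin\<close>.\<close>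

lemma subseq_snoc_append_notin:
  assumes "y \<notin> set zs" "subseq (xs @ [y]) (ys @ zs)"
  shows "subseq (xs @ [y]) ys"
proof -
  from assms(2) obtain s t where st: "xs @ [y] = s @ t" "subseq s ys" "subseq t zs"
    by (rule subseq_appendE)
  have "t = []"
  proof (cases t rule: rev_cases)
    case (snoc t' z)
    then have "y \<in> set t" using st(1) by simp
    moreover have "set t \<subseteq> set zs" using st(3) by (auto elim: list_emb_set)
    ultimately show ?thesis using assms(1) by auto
  qed
  with st show ?thesis by simp
qed

text \<open>The \<open>x\<close> of the pattern can only be matched inside \<open>m\<close>, and
  \<open>m\<close> can host nothing else of the pattern. Hence \<open>p\<close> is matched before
  the block and \<open>q\<close> after it.\<close>

lemma subseq_around_block:
  assumes "subseq (p @ x # q) (u @ m @ v)" "set m \<subseteq> {x}"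
    and "x \<notin> set u" "x \<notin> set v" "x \<notin> set p" "x \<notin> set q"
  shows "subseq p u" "subseq q v"
proof -
  obtain r s t where rst: "p @ x # q = r @ s @ t" "subseq r u" "subseq s m" "subseq t v"
    using assms(1) unfolding subseq_append_iff by blast
  have sets: "x \<notin> set r" "x \<notin> set t" "set s \<subseteq> {x}"
    using rst(2-4) assms(2-4) by (auto elim: list_emb_set)
  moreover have "x \<in> set (r @ s @ t)"
    unfolding rst(1)[symmetric] by simp
  ultimately obtain s' where s: "s = x # s'"
    by (cases s) auto
  \<comment> \<open>As \<open>x\<close> occurs just once in the pattern, cutting there is unique; a
    further copy in \<open>s'\<close> would lie in \<open>q\<close>.\<close>
  with rst(1) sets assms(5,6) have "p = r" "q = s' @ t"
    by (auto simp: append_Cons_eq_iff)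
  moreover from this s sets assms(6) have "s' = []"
    by (cases s') auto
  ultimately show "subseq p u" "subseq q v" using rst by auto
qed

section \<open>Inserting a new smallest letter\<close>

lemma class_112_subseq: "class_112 w \<Longrightarrow> subseq v w \<Longrightarrow> class_112 v"
  unfolding class_112_def using subseq_order.trans by blast

lemma class_121_subseq: "class_121 w \<Longrightarrow> subseq v w \<Longrightarrow> class_121 v"
  unfolding class_121_def using subseq_order.trans by blast

text \<open>For \<open>a < b\<close> this is the excluded 2212; for \<open>b < a\<close> the first
  three letters already form a 112.\<close>

lemma class_112_contiguous: "class_112 w \<Longrightarrow> a \<noteq> b \<Longrightarrow> \<not> subseq [b, b, a, b] w"
proof
  assume *: "class_112 w" "a \<noteq> b" "subseq [b, b, a, b] w"
  have "subseq [b, b, a] [b, b, a, b]" by simp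
  with * show False
    unfolding class_112_def using subseq_order.trans linorder_neqE by metis
qed

text \<open>For \<open>b < a\<close> the last three letters form a 121.\<close>

lemma class_121_contiguous: "class_121 w \<Longrightarrow> a \<noteq> b \<Longrightarrow> \<not> subseq [b, b, a, b] w"
proof
  assume *: "class_121 w" "a \<noteq> b" "subseq [b, b, a, b] w"
  have "subseq [b, a, b] [b, b, a, b]" by simp
  with * show False
    unfolding class_121_def using subseq_order.trans linorder_neqE by metis
qed

text \<open>Two copies of \<open>b\<close> in \<open>u\<close>, the letter \<open>x\<close> and a
  copy of \<open>b\<close> in \<open>v\<close> would spell out a 2212.\<close>

lemma no_2212_across_of_insert:
  assumes "\<And>a b. a < b \<Longrightarrow> \<not> subseq [b, b, a, b] w" "subseq (u @ x # v) w" "\<forall>y\<in>set v. x < y"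
  shows "no_2212_across u v"
  unfolding no_2212_across_def
proof (intro allI notI, elim conjE)
  fix b assume b: "2 \<le> count_list u b" "b \<in> set v"
  have "subseq ([b, b] @ [x, b]) (u @ x # v)"
    using b by (intro list_emb_append_mono) (simp_all add: subseq_two_iff subseq_singleton_left)
  with assms(2) have "subseq [b, b, x, b] w" using subseq_order.trans by force
  with assms(1,3) b(2) show False by blast
qed

lemma subseq_remove_letter:
  assumes "subseq xs w" "x \<notin> set xs" shows "subseq xs (filter (\<lambda>y. y \<noteq> x) w)"
proof -
  have "filter (\<lambda>y. y \<noteq> x) xs = xs" using assms(2) by (auto simp: filter_id_conv)
  with subseq_filter[OF assms(1), of "\<lambda>y. y \<noteq> x"] show ?thesis by simp
qed

text \<open>In a 2212 only the small letter can be \<open>x\<close>. If it is, the block separates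
  two copies of \<open>b\<close> from a third, against \<open>across\<close>; if not, deleting all
  \<open>x\<close> leaves the occurrence in \<open>u @ v\<close>.\<close>

lemma no_2212_insert_block:
  fixes x :: "'a::linorder"
  assumes uv: "\<And>a b. a < b \<Longrightarrow> \<not> subseq [b, b, a, b] (u @ v)"
    and across: "no_2212_across u v"
    and m: "set m \<subseteq> {x}" and min: "\<forall>y\<in>set (u @ v). x < y" and "a < b"
  shows "\<not> subseq [b, b, a, b] (u @ m @ v)"
proof
  assume sub: "subseq [b, b, a, b] (u @ m @ v)"
  have "a \<in> set (u @ m @ v)" using subseq_set_subset[OF sub] by simp
  then have "x \<le> a" using min m by (auto simp: less_imp_le)
  with \<open>a < b\<close> have "x < b" by simp
  show False
  proof (cases "a = x")
    case True
    with sub have "subseq ([b, b] @ x # [b]) (u @ m @ v)" by simp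
    from subseq_around_block[OF this m] min \<open>x < b\<close> have "subseq [b, b] u" "subseq [b] v"
      by auto
    with across show False
      by (auto simp: no_2212_across_def subseq_two_iff subseq_singleton_left)
  next
    case False
    with sub \<open>x < b\<close> have "subseq [b, b, a, b] (filter (\<lambda>y. y \<noteq> x) (u @ m @ v))"
      by (intro subseq_remove_letter) auto
    moreover have "filter (\<lambda>y. y \<noteq> x) u = u" "filter (\<lambda>y. y \<noteq> x) v = v"
      "filter (\<lambda>y. y \<noteq> x) m = []"
      using m min by (auto simp: filter_id_conv filter_empty_conv)
    then have "filter (\<lambda>y. y \<noteq> x) (u @ m @ v) = u @ v" by simp
    ultimately show False using uv \<open>a < b\<close> by simp
  qed
qed

text \<open>Necessity follows by passing to the subsequences \<open>u @ v\<close> and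
  \<open>u @ x # v\<close>. Conversely, nothing larger follows the second \<open>x\<close>, so no
  112 starts with \<open>x\<close>; and a 2212 ends in a letter above \<open>x\<close>, so the
  trailing run takes no part in it.\<close>

lemma class_112_insert:
  assumes min: "\<forall>y\<in>set (u @ v). x < y"
  shows "class_112 (u @ x # v @ replicate n x) \<longleftrightarrow> class_112 (u @ v) \<and> no_2212_across u v"
    (is "class_112 ?w \<longleftrightarrow> _")
proof
  assume w: "class_112 ?w"
  have "subseq (u @ v) ?w" "subseq (u @ x # v) ?w"
    by (simp_all add: subseq_append' list_emb_Cons subseq_rev_drop_many)
  moreover have "\<not> subseq [b, b, a, b] ?w" if "a < b" for a b
    using w that by (simp add: class_112_def)
  ultimately show "class_112 (u @ v) \<and> no_2212_across u v"
    using class_112_subseq[OF w] no_2212_across_of_insert[of ?w u x v] min by simp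
next
  assume uv: "class_112 (u @ v) \<and> no_2212_across u v"
  have "\<not> subseq [a, a, b] ?w \<and> \<not> subseq [b, b, a, b] ?w" if "a < b" for a b
  proof (intro conjI notI)
    assume sub: "subseq [a, a, b] ?w"
    have "a \<in> set ?w" using subseq_set_subset[OF sub] by simp
    then have "x \<le> a" using min by (auto simp: less_imp_le)
    with \<open>a < b\<close> have b: "x < b" by simp
    show False
    proof (cases "a = x")
      case True
      have "x \<notin> set u" "x \<notin> set v" using min by auto
      \<comment> \<open>The inserted copy absorbs the first \<open>x\<close>, since \<open>u\<close>
        has none; the second must lie in the trailing run, since \<open>v\<close> has none
        either.\<close>
      with sub True have "subseq [x, b] (replicate n x)"
        by (simp add: subseq_Cons_append_notin)
      from subseq_set_subset[OF this] have "b \<in> set (replicate n x)" by simp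
      with b show False by auto
    next
      case False
      with sub b have "subseq [a, a, b] (filter (\<lambda>y. y \<noteq> x) ?w)"
        by (intro subseq_remove_letter) auto
      moreover have "filter (\<lambda>y. y \<noteq> x) u = u" "filter (\<lambda>y. y \<noteq> x) v = v"
        using min by (auto simp: filter_id_conv)
      then have "filter (\<lambda>y. y \<noteq> x) ?w = u @ v" by simp
      ultimately show False using uv \<open>a < b\<close> by (auto simp: class_112_def)
    qed
  next
    assume sub: "subseq [b, b, a, b] ?w"
    have "a \<in> set ?w" using subseq_set_subset[OF sub] by simp
    then have "x \<le> a" using min by (auto simp: less_imp_le)
    with \<open>a < b\<close> have "b \<notin> set (replicate n x)" by auto
    with sub have "subseq [b, b, a, b] (u @ [x] @ v)"
      using subseq_snoc_append_notin[of b "replicate n x" "[b, b, a]" "u @ [x] @ v"] by simp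
    with no_2212_insert_block[of u v "[x]" x a b] uv min \<open>a < b\<close> show False
      by (auto simp: class_112_def)
  qed
  then show "class_112 ?w" by (simp add: class_112_def)
qed

text \<open>As for 112, except that both ends of a 121 on \<open>x\<close> would lie in the block,
  leaving no room for a larger letter between them.\<close>

lemma class_121_insert:
  assumes min: "\<forall>y\<in>set (u @ v). x < y"
  shows "class_121 (u @ x # replicate n x @ v) \<longleftrightarrow> class_121 (u @ v) \<and> no_2212_across u v"
    (is "class_121 ?w \<longleftrightarrow> _")
proof
  assume w: "class_121 ?w"
  have "subseq (u @ v) ?w" "subseq (u @ x # v) ?w"
    by (simp_all add: subseq_append' list_emb_Cons subseq_drop_many)
  moreover have "\<not> subseq [b, b, a, b] ?w" if "a < b" for a b
    using w that by (simp add: class_121_def)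
  ultimately show "class_121 (u @ v) \<and> no_2212_across u v"
    using class_121_subseq[OF w] no_2212_across_of_insert[of ?w u x v] min by simp
next
  assume uv: "class_121 (u @ v) \<and> no_2212_across u v"
  have "\<not> subseq [a, b, a] ?w \<and> \<not> subseq [b, b, a, b] ?w" if "a < b" for a b
  proof (intro conjI notI)
    assume sub: "subseq [a, b, a] ?w"
    have "a \<in> set ?w" using subseq_set_subset[OF sub] by simp
    then have "x \<le> a" using min by (auto simp: less_imp_le)
    with \<open>a < b\<close> have b: "x < b" by simp
    show False
    proof (cases "a = x")
      case True
      have "x \<notin> set u" "x \<notin> set v" using min by auto
      with sub True have "subseq [x, b, x] (replicate (Suc n) x @ v)"
        by (simp add: subseq_Cons_append_notin)
      then have "subseq [x, b, x] (replicate (Suc n) x)"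
        using subseq_snoc_append_notin[of x v "[x, b]" "replicate (Suc n) x"] \<open>x \<notin> set v\<close> by simp
      from subseq_set_subset[OF this] have "b \<in> set (replicate (Suc n) x)" by simp
      with b show False by auto
    next
      case False
      with sub b have "subseq [a, b, a] (filter (\<lambda>y. y \<noteq> x) ?w)"
        by (intro subseq_remove_letter) auto
      moreover have "filter (\<lambda>y. y \<noteq> x) u = u" "filter (\<lambda>y. y \<noteq> x) v = v"
        using min by (auto simp: filter_id_conv)
      then have "filter (\<lambda>y. y \<noteq> x) ?w = u @ v" by simp
      ultimately show False using uv \<open>a < b\<close> by (auto simp: class_121_def)
    qed
  next
    assume sub: "subseq [b, b, a, b] ?w"
    \<comment> \<open>The inserted \<open>x\<close> and the \<open>n\<close> copies after it
      together serve as the block \<open>m\<close>.\<close>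
    have "set (replicate (Suc n) x) \<subseteq> {x}" by (simp only: set_replicate_Suc)
    from no_2212_insert_block[of u v, OF _ _ this] sub uv min \<open>a < b\<close> show False
      by (auto simp: class_121_def)
  qed
  then show "class_121 ?w" by (simp add: class_121_def)
qed

section \<open>Decomposing a word at its smallest letter\<close>

text \<open>Cut at the first two copies of \<open>x\<close>: any larger letter after the second
  would complete a 112. The case \<open>n = 0\<close> is that of a single copy.\<close>

lemma class_112_split:
  assumes w: "class_112 w" and "x \<in> set w" and min: "\<forall>y\<in>set w. x \<le> y"
  obtains u v n where "w = u @ x # v @ replicate n x" "x \<notin> set u" "x \<notin> set v"
proof -
  obtain u r where ur: "w = u @ x # r" "x \<notin> set u"
    using split_list_first[OF \<open>x \<in> set w\<close>] by blast
  show thesis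
  proof (cases "x \<in> set r")
    case False
    then show thesis using that[of u r 0] ur by simp
  next
    case True
    then obtain v t where vt: "r = v @ x # t" "x \<notin> set v"
      using split_list_first by metis
    have "y = x" if "y \<in> set t" for y
    proof (rule ccontr)
      assume "y \<noteq> x"
      with min that ur vt have "x < y" by (auto simp: le_less)
      moreover have "subseq [x, x, y] w"
        unfolding ur vt using that
        by (intro subseq_drop_many) (auto intro!: subseq_drop_many simp: subseq_singleton_left)
      ultimately show False using w by (auto simp: class_112_def)
    qed
    then have "x # t = replicate (Suc (length t)) x"
      by (auto intro: replicate_eqI)
    then show thesis using that[of u v "Suc (length t)"] ur vt by simp
  qed
qed

text \<open>Cut at the first and the last copy of \<open>x\<close>: any larger letter between them
  would give a 121.\<close>

lemma class_121_split:
  assumes w: "class_121 w" and "x \<in> set w" and min: "\<forall>y\<in>set w. x \<le> y"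
  obtains u v n where "w = u @ x # replicate n x @ v" "x \<notin> set u" "x \<notin> set v"
proof -
  obtain u r where ur: "w = u @ x # r" "x \<notin> set u"
    using split_list_first[OF \<open>x \<in> set w\<close>] by blast
  show thesis
  proof (cases "x \<in> set r")
    case False
    then show thesis using that[of u 0 r] ur by simp
  next
    case True
    then obtain t v where tv: "r = t @ x # v" "x \<notin> set v"
      using split_list_last by metis
    have "y = x" if "y \<in> set t" for y
    proof (rule ccontr)
      assume "y \<noteq> x"
      with min that ur tv have "x < y" by (auto simp: le_less)
      moreover have "subseq ([y] @ [x]) (t @ x # v)"
        using that by (intro list_emb_append_mono) (auto simp: subseq_singleton_left)
      then have "subseq [x, y, x] w"
        unfolding ur tv by (intro subseq_drop_many) simp
      ultimately show False using w by (auto simp: class_121_def)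
    qed
    then have "t @ [x] = replicate (Suc (length t)) x"
      by (intro replicate_eqI) auto
    then show thesis using that[of u "Suc (length t)" v] ur tv by simp
  qed
qed

section \<open>The product recursion for both classes\<close>

text \<open>The map \<open>I\<close> abstracts from how the \<open>Suc n\<close> copies of
  \<open>x\<close> are placed once a gap is chosen. Words of the larger class correspond to pairs of
  a smaller word and an admissible gap, and the number of such gaps is the same for all words over
  \<open>S\<close>.\<close>

lemma card_class_insert:
  fixes C :: "'a::linorder list \<Rightarrow> bool" and I :: "'a list \<Rightarrow> 'a list \<Rightarrow> 'a list"
  assumes min: "\<forall>y\<in>#S. x < y"
    and contiguous: "\<And>w a b. C w \<Longrightarrow> a \<noteq> b \<Longrightarrow> \<not> subseq [b, b, a, b] w"
    and ins: "\<And>u v. \<forall>y\<in>set (u @ v). x < y \<Longrightarrow> C (I u v) \<longleftrightarrow> C (u @ v) \<and> no_2212_across u v"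
    and mset_I: "\<And>u v. mset (I u v) = mset (u @ v) + replicate_mset (Suc n) x"
    and inj_I: "\<And>u v u' v'. x \<notin> set (u @ v) \<Longrightarrow> x \<notin> set (u' @ v') \<Longrightarrow> I u v = I u' v' \<Longrightarrow> u = u' \<and> v = v'"
    and split: "\<And>w. C w \<Longrightarrow> \<forall>y\<in>set w. x \<le> y \<Longrightarrow> count (mset w) x = Suc n \<Longrightarrow>
      \<exists>u v. w = I u v \<and> x \<notin> set (u @ v)"
  shows "card {w \<in> permutations_of_multiset (S + replicate_mset (Suc n) x). C w} =
    card {w \<in> permutations_of_multiset S. C w} * Suc (\<Sum>b\<in>set_mset S. min 2 (count S b))"
proof -
  let ?W = "\<lambda>S. {w \<in> permutations_of_multiset S. C w}"
  let ?S' = "S + replicate_mset (Suc n) x"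
  let ?f = "\<lambda>(w, p). I (take p w) (drop p w)"
  have big: "\<forall>y\<in>set w. x < y" if "w \<in> ?W S" for w
    using that min by (auto simp: permutations_of_multiset_def)
  have "bij_betw ?f (SIGMA w:?W S. gaps w) (?W ?S')"
    unfolding bij_betw_def
  proof
    show "inj_on ?f (SIGMA w:?W S. gaps w)"
    proof (rule inj_onI, clarify)
      fix w p w' p'
      assume w: "w \<in> permutations_of_multiset S" "C w" "p \<in> gaps w"
        and w': "w' \<in> permutations_of_multiset S" "C w'" "p' \<in> gaps w'"
        and eq: "I (take p w) (drop p w) = I (take p' w') (drop p' w')"
      have "x \<notin> set w" "x \<notin> set w'" using big w w' by auto
      then have td: "take p w = take p' w'" "drop p w = drop p' w'"
        using inj_I[OF _ _ eq] by auto
      then have "w = w'" by (metis append_take_drop_id)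
      \<comment> \<open>Since gaps satisfy \<open>p \<le> length w\<close>, the length of the prefix
        recovers \<open>p\<close>.\<close>
      moreover from td(1) have "length (take p w) = length (take p' w')" by simp
      then have "p = p'" using w(3) w'(3) by (simp add: gaps_def)
      ultimately show "w = w' \<and> p = p'" by simp
    qed
    show "?f ` (SIGMA w:?W S. gaps w) = ?W ?S'"
    proof (intro equalityI subsetI)
      fix z assume "z \<in> ?f ` (SIGMA w:?W S. gaps w)"
      then obtain w p where wp: "w \<in> ?W S" "p \<in> gaps w" "z = I (take p w) (drop p w)" by auto
      then show "z \<in> ?W ?S'"
        using ins[of "take p w" "drop p w"] big[OF wp(1)] mset_I[of "take p w" "drop p w"]
        by (auto simp: permutations_of_multiset_def gaps_def
            simp flip: mset_append)
    next
      fix z assume z: "z \<in> ?W ?S'"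
      then have mz: "mset z = ?S'" "C z" by (auto simp: permutations_of_multiset_def)
      have "set z = set_mset ?S'" using mz(1) by (metis set_mset_mset)
      then have "\<forall>y\<in>set z. x \<le> y" using min by (auto simp: less_imp_le)
      moreover have "x \<notin># S" using min by auto
      then have "count (mset z) x = Suc n" using mz(1) by (simp add: not_in_iff)
      ultimately obtain u v where uv: "z = I u v" "x \<notin> set (u @ v)"
        using split mz(2) by blast
      have muv: "mset (u @ v) = S" using mset_I[of u v] mz(1) uv(1) by simp
      then have "\<forall>y\<in>set (u @ v). x < y" using min by (metis set_mset_mset)
      from ins[OF this] mz(2) uv(1) have "C (u @ v)" "no_2212_across u v" by auto
      then have "(u @ v, length u) \<in> (SIGMA w:?W S. gaps w)"
        using muv by (auto simp: permutations_of_multiset_def gaps_def)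
      moreover have "z = ?f (u @ v, length u)" using uv(1) by simp
      ultimately show "z \<in> ?f ` (SIGMA w:?W S. gaps w)" by blast
    qed
  qed
  then have "card (?W ?S') = card (SIGMA w:?W S. gaps w)"
    by (simp add: bij_betw_same_card)
  also have "\<dots> = (\<Sum>w\<in>?W S. card (gaps w))"
    by (intro card_SigmaI) (auto simp: gaps_def)
  also have "\<dots> = (\<Sum>w\<in>?W S. Suc (\<Sum>b\<in>set_mset S. min 2 (count S b)))"
  proof (rule sum.cong)
    fix w assume w: "w \<in> ?W S"
    then have "mset w = S" by (simp add: permutations_of_multiset_def)
    moreover from this have "set w = set_mset S" by (metis set_mset_mset)
    ultimately show "card (gaps w) = Suc (\<Sum>b\<in>set_mset S. min 2 (count S b))"
      using card_gaps[of w] contiguous w by simp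
  qed simp
  finally show ?thesis by simp
qed

lemma card_class_112_insert:
  assumes "\<forall>y\<in>#S. x < y"
  shows "card {w \<in> permutations_of_multiset (S + replicate_mset (Suc n) x). class_112 w} =
    card {w \<in> permutations_of_multiset S. class_112 w} * Suc (\<Sum>b\<in>set_mset S. min 2 (count S b))"
proof (rule card_class_insert[where I = "\<lambda>u v. u @ x # v @ replicate n x"])
  fix w assume w: "class_112 w" "\<forall>y\<in>set w. x \<le> y" "count (mset w) x = Suc n"
  from w(3) have "x \<in> set w" by (metis count_mset count_notin nat.distinct(1))
  from class_112_split[OF w(1) this w(2)] obtain u v m
    where *: "w = u @ x # v @ replicate m x" "x \<notin> set u" "x \<notin> set v" .
  with w(3) have "m = n" by (simp add: count_mset)
  with * show "\<exists>u v. w = u @ x # v @ replicate n x \<and> x \<notin> set (u @ v)" by auto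
qed (simp_all add: assms class_112_contiguous class_112_insert append_Cons_eq_iff)

lemma card_class_121_insert:
  assumes "\<forall>y\<in>#S. x < y"
  shows "card {w \<in> permutations_of_multiset (S + replicate_mset (Suc n) x). class_121 w} =
    card {w \<in> permutations_of_multiset S. class_121 w} * Suc (\<Sum>b\<in>set_mset S. min 2 (count S b))"
proof (rule card_class_insert[where I = "\<lambda>u v. u @ x # replicate n x @ v"])
  fix w assume w: "class_121 w" "\<forall>y\<in>set w. x \<le> y" "count (mset w) x = Suc n"
  from w(3) have "x \<in> set w" by (metis count_mset count_notin nat.distinct(1))
  from class_121_split[OF w(1) this w(2)] obtain u v m
    where *: "w = u @ x # replicate m x @ v" "x \<notin> set u" "x \<notin> set v" .
  with w(3) have "m = n" by (simp add: count_mset)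
  with * show "\<exists>u v. w = u @ x # replicate n x @ v \<and> x \<notin> set (u @ v)" by auto
next
  fix u v u' v'
  assume x: "x \<notin> set (u @ v)" "x \<notin> set (u' @ v')"
    and eq: "u @ x # replicate n x @ v = u' @ x # replicate n x @ v'"
  \<comment> \<open>The copies of \<open>x\<close> after the first keep the cut from being unique at
    an arbitrary \<open>x\<close>; \<open>u\<close> is recovered as the part before the first
    one.\<close>
  have "takeWhile (\<lambda>y. y \<noteq> x) (s @ x # t) = s" if "x \<notin> set s" for s t
    using that by (induction s) auto
  from this[of u "replicate n x @ v"] this[of u' "replicate n x @ v'"] x eq have "u = u'"
    by simp
  with eq show "u = u' \<and> v = v'" by simp
qed (simp_all add: assms class_121_contiguous class_121_insert)

section \<open>Equality of the two counts\<close>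

text \<open>Removing all copies of the least letter yields the same factor in both classes. The
  induction ranges over all multisets because the letters left over from a reduced one no longer
  start at 1.\<close>

lemma card_class_112_eq_card_class_121:
  "card {w \<in> permutations_of_multiset S. class_112 w} =
    card {w \<in> permutations_of_multiset S. class_121 w}"
proof (induction "size S" arbitrary: S rule: less_induct)
  case less
  show ?case
  proof (cases "S = {#}")
    case True
    then show ?thesis by (auto simp: class_112_def class_121_def intro: arg_cong[of _ _ card])
  next
    case False
    define x where "x = Min (set_mset S)"
    define T where "T = filter_mset (\<lambda>y. y \<noteq> x) S"
    have x: "x \<in># S" using False by (simp add: x_def)
    then obtain n where n: "count S x = Suc n"
      by (metis count_greater_zero_iff gr0_implies_Suc)
    have S: "S = T + replicate_mset (Suc n) x"
      unfolding T_def using n by (intro multiset_eqI) auto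
    have "\<forall>y\<in>#T. x < y"
      unfolding T_def x_def by (auto simp: le_less intro: Min_le dest: Min_le[rotated])
    moreover have "size T < size S" by (simp add: S)
    then have "card {w \<in> permutations_of_multiset T. class_112 w} =
        card {w \<in> permutations_of_multiset T. class_121 w}"
      by (rule less.hyps)
    ultimately show ?thesis
      unfolding S by (simp only: card_class_112_insert card_class_121_insert)
  qed
qed

theorem theorem2p11:
  shows "m_equivalent {[1, 1, 2], [2, 2, 1, 2]} {[1, 2, 1], [2, 1, 2, 2]}"
  unfolding m_equivalent_def
proof (intro allI impI)
  fix S :: "nat multiset"
  have "av S {[1, 1, 2], [2, 2, 1, 2]} = card {w \<in> permutations_of_multiset S. class_112 w}"
    unfolding av_def avoids_def class_112_def
    by (rule arg_cong[of _ _ card], simp only: ball_simps contains_112_iff contains_2212_iff) blast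
  also have "\<dots> = card {w \<in> permutations_of_multiset S. class_121 w}"
    by (rule card_class_112_eq_card_class_121)
  \<comment> \<open>Reversal is injective and keeps the multiset of letters; it fixes 121 and
    exchanges 2212 with 2122.\<close>
  also have "\<dots> = card (rev ` {w \<in> permutations_of_multiset S. class_121 w})"
    by (simp add: card_image)
  also have "rev ` {w \<in> permutations_of_multiset S. class_121 w} =
      {w \<in> permutations_of_multiset S. class_121 (rev w)}"
    by (auto simp: permutations_of_multiset_def image_iff intro!: exI[of _ "rev _"])
  also have "card \<dots> = av S {[1, 2, 1], [2, 1, 2, 2]}"
    unfolding av_def avoids_def class_121_def subseq_rev_iff
    by (rule arg_cong[of _ _ card],
        simp only: ball_simps contains_121_iff contains_2122_iff rev.simps append.simps) blast
  finally show "av S {[1, 1, 2], [2, 2, 1, 2]} = av S {[1, 2, 1], [2, 1, 2, 2]}" .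
qed

end
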